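(* Let $\mathfrak{g}$ be a perfect Lie algebra over a field of characteristic $p\neq 2$. Suppose that $\mathfrak{g}$ is taut. Then every CPA-structure on $\mathfrak{g}$ is trivial (i.e. satisfies $x\cdot y=0$ for all $x,y\in\mathfrak{g}$). In particular, every perfect Lie algebra over a field of characteristic $p\neq 2$ whose outer derivation algebra is solvable admits only the trivial CPA-structure.
   Context: All Lie algebras are finite-dimensional. A Lie algebra $\mathfrak{g}$ is perfect if $[\mathfrak{g},\mathfrak{g}]=\mathfrak{g}$. $\mathrm{Der}(\mathfrak{g})$ is the Lie algebra of derivations of $\mathfrak{g}$, $\mathrm{Inn}(\mathfrak{g})$ the ideal of inner derivations $\mathrm{ad}(x)$, and $\mathrm{Out}(\mathfrak{g})=\mathrm{Der}(\mathfrak{g})/\mathrm{Inn}(\mathfrak{g})$ the outer derivation algebra. $\mathfrak{g}$ is called taut if every Lie algebra homomorphism $\varphi\colon\mathfrak{g}\to\mathrm{Der}(\mathfrak{g})$ satisfies $\varphi(\mathfrak{g})\subseteq\mathrm{Inn}(\mathfrak{g})$. A CPA-structure on a Lie algebra $\mathfrak{g}$ over a field $K$ is a $K$-bilinear product $x\cdot y$ on $\mathfrak{g}$ satisfying, for all $x,y,z\in\mathfrak{g}$: $x\cdot y=y\cdot x$; $[x,y]\cdot z=x\cdot(y\cdot z)-y\cdot(x\cdot z)$; $x\cdot[y,z]=[x\cdot y,z]+[y,x\cdot z]$. *)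

theory Defs
  imports "Jordan_Normal_Form.Missing_VectorSpace" "HOL-Algebra.Multiplicative_Group"
begin

text \<open>The characteristic is the order of \<open>1\<close> in the additive group; \<^const>\<open>group.ord\<close> is \<open>0\<close> for
  elements of infinite order.\<close>

definition ring_char :: "('k, 'c) ring_scheme \<Rightarrow> nat" where
  "ring_char R = group.ord (add_monoid R) \<one>\<^bsub>R\<^esub>"

section \<open>Lie algebras\<close>

text \<open>The fields \<open>mult\<close> and \<open>one\<close> inherited from \<open>ring\<close> play no role, as in
  the modules of \<open>HOL-Algebra\<close>.\<close>

record ('k, 'a) lie_algebra = "('k, 'a) module" +
  bracket :: "'a \<Rightarrow> 'a \<Rightarrow> 'a"  (\<open>\<lbrace>_, _\<rbrace>\<index>\<close>)

locale lie_algebra = vectorspace K L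
  for K :: "('k, 'c) ring_scheme"
    and L :: "('k, 'a, 'd) lie_algebra_scheme" (structure) +
  assumes bracket_closed: "\<lbrakk>x \<in> carrier L; y \<in> carrier L\<rbrakk> \<Longrightarrow> \<lbrace>x, y\<rbrace> \<in> carrier L"
    and bracket_add_left: "\<lbrakk>x \<in> carrier L; y \<in> carrier L; z \<in> carrier L\<rbrakk> \<Longrightarrow>
      \<lbrace>x \<oplus> y, z\<rbrace> = \<lbrace>x, z\<rbrace> \<oplus> \<lbrace>y, z\<rbrace>"
    and bracket_add_right: "\<lbrakk>x \<in> carrier L; y \<in> carrier L; z \<in> carrier L\<rbrakk> \<Longrightarrow>
      \<lbrace>x, y \<oplus> z\<rbrace> = \<lbrace>x, y\<rbrace> \<oplus> \<lbrace>x, z\<rbrace>"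
    and bracket_smult_left: "\<lbrakk>a \<in> carrier K; x \<in> carrier L; y \<in> carrier L\<rbrakk> \<Longrightarrow>
      \<lbrace>a \<odot> x, y\<rbrace> = a \<odot> \<lbrace>x, y\<rbrace>"
    and bracket_smult_right: "\<lbrakk>a \<in> carrier K; x \<in> carrier L; y \<in> carrier L\<rbrakk> \<Longrightarrow>
      \<lbrace>x, a \<odot> y\<rbrace> = a \<odot> \<lbrace>x, y\<rbrace>"
    and bracket_self: "x \<in> carrier L \<Longrightarrow> \<lbrace>x, x\<rbrace> = \<zero>"
    and jacobi: "\<lbrakk>x \<in> carrier L; y \<in> carrier L; z \<in> carrier L\<rbrakk> \<Longrightarrow>
      \<lbrace>x, \<lbrace>y, z\<rbrace>\<rbrace> \<oplus> \<lbrace>y, \<lbrace>z, x\<rbrace>\<rbrace> \<oplus> \<lbrace>z, \<lbrace>x, y\<rbrace>\<rbrace> = \<zero>"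

definition lie_hom :: "('k, 'c) ring_scheme \<Rightarrow> ('k, 'a, 'd) lie_algebra_scheme \<Rightarrow>
    ('k, 'b, 'e) lie_algebra_scheme \<Rightarrow> ('a \<Rightarrow> 'b) set" where
  "lie_hom K L M = {f \<in> LinearCombinations.module_hom K L M.
     \<forall>x\<in>carrier L. \<forall>y\<in>carrier L. f \<lbrace>x, y\<rbrace>\<^bsub>L\<^esub> = \<lbrace>f x, f y\<rbrace>\<^bsub>M\<^esub>}"

definition bracket_span :: "('k, 'c) ring_scheme \<Rightarrow> ('k, 'a, 'd) lie_algebra_scheme \<Rightarrow>
    'a set \<Rightarrow> 'a set \<Rightarrow> 'a set" where
  "bracket_span K L A B = LinearCombinations.module.span K L {\<lbrace>x, y\<rbrace>\<^bsub>L\<^esub> | x y. x \<in> A \<and> y \<in> B}"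

definition perfect :: "('k, 'c) ring_scheme \<Rightarrow> ('k, 'a, 'd) lie_algebra_scheme \<Rightarrow> bool" where
  "perfect K L \<longleftrightarrow> bracket_span K L (carrier L) (carrier L) = carrier L"

primrec derived_series :: "('k, 'c) ring_scheme \<Rightarrow> ('k, 'a, 'd) lie_algebra_scheme \<Rightarrow>
    nat \<Rightarrow> 'a set" where
  "derived_series K L 0 = carrier L"
| "derived_series K L (Suc n) =
     bracket_span K L (derived_series K L n) (derived_series K L n)"

definition lie_solvable :: "('k, 'c) ring_scheme \<Rightarrow> ('k, 'a, 'd) lie_algebra_scheme \<Rightarrow> bool" where
  "lie_solvable K L \<longleftrightarrow> (\<exists>n. derived_series K L n = {\<zero>\<^bsub>L\<^esub>})"

text \<open>The quotient by an ideal, on additive cosets, built as the quotient rings of \<open>HOL-Algebra\<close> are.\<close>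

definition lie_quot :: "('k, 'a, 'd) lie_algebra_scheme \<Rightarrow> 'a set \<Rightarrow> ('k, 'a set) lie_algebra" where
  "lie_quot L I =
    \<lparr>carrier = a_rcosets\<^bsub>L\<^esub> I, mult = undefined, one = undefined,
     zero = I, add = set_add L,
     smult = (\<lambda>c A. \<Union>a\<in>A. I +>\<^bsub>L\<^esub> (c \<odot>\<^bsub>L\<^esub> a)),
     bracket = (\<lambda>A B. \<Union>a\<in>A. \<Union>b\<in>B. I +>\<^bsub>L\<^esub> \<lbrace>a, b\<rbrace>\<^bsub>L\<^esub>)\<rparr>"

section \<open>Derivations\<close>

text \<open>Derivations are taken to be \<^const>\<open>extensional\<close>, so that equality of maps on
  \<open>carrier L\<close> is equality in HOL.\<close>

definition derivations :: "('k, 'c) ring_scheme \<Rightarrow> ('k, 'a, 'd) lie_algebra_scheme \<Rightarrow>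
    ('a \<Rightarrow> 'a) set" where
  "derivations K L = {D \<in> LinearCombinations.module_hom K L L \<inter> extensional (carrier L).
     \<forall>x\<in>carrier L. \<forall>y\<in>carrier L. D \<lbrace>x, y\<rbrace>\<^bsub>L\<^esub> = \<lbrace>D x, y\<rbrace>\<^bsub>L\<^esub> \<oplus>\<^bsub>L\<^esub> \<lbrace>x, D y\<rbrace>\<^bsub>L\<^esub>}"

definition Der :: "('k, 'c) ring_scheme \<Rightarrow> ('k, 'a, 'd) lie_algebra_scheme \<Rightarrow>
    ('k, 'a \<Rightarrow> 'a) lie_algebra" where
  "Der K L =
    \<lparr>carrier = derivations K L, mult = undefined, one = undefined,
     zero = (\<lambda>x\<in>carrier L. \<zero>\<^bsub>L\<^esub>),
     add = (\<lambda>D E. \<lambda>x\<in>carrier L. D x \<oplus>\<^bsub>L\<^esub> E x),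
     smult = (\<lambda>c D. \<lambda>x\<in>carrier L. c \<odot>\<^bsub>L\<^esub> D x),
     bracket = (\<lambda>D E. \<lambda>x\<in>carrier L. D (E x) \<ominus>\<^bsub>L\<^esub> E (D x))\<rparr>"

definition ad :: "('k, 'a, 'd) lie_algebra_scheme \<Rightarrow> 'a \<Rightarrow> 'a \<Rightarrow> 'a" where
  "ad L x = (\<lambda>y\<in>carrier L. \<lbrace>x, y\<rbrace>\<^bsub>L\<^esub>)"

definition Inn :: "('k, 'a, 'd) lie_algebra_scheme \<Rightarrow> ('a \<Rightarrow> 'a) set" where
  "Inn L = ad L ` carrier L"

definition Out :: "('k, 'c) ring_scheme \<Rightarrow> ('k, 'a, 'd) lie_algebra_scheme \<Rightarrow>
    ('k, ('a \<Rightarrow> 'a) set) lie_algebra" where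
  "Out K L = lie_quot (Der K L) (Inn L)"

definition taut :: "('k, 'c) ring_scheme \<Rightarrow> ('k, 'a, 'd) lie_algebra_scheme \<Rightarrow> bool" where
  "taut K L \<longleftrightarrow> (\<forall>\<phi>\<in>lie_hom K L (Der K L). \<phi> ` carrier L \<subseteq> Inn L)"

section \<open>CPA-structures\<close>

locale cpa_structure = lie_algebra K L
  for K :: "('k, 'c) ring_scheme"
    and L :: "('k, 'a, 'd) lie_algebra_scheme" (structure) +
  fixes cpa :: "'a \<Rightarrow> 'a \<Rightarrow> 'a" (infixl \<open>\<bullet>\<close> 75)
  assumes cpa_closed: "\<lbrakk>x \<in> carrier L; y \<in> carrier L\<rbrakk> \<Longrightarrow> x \<bullet> y \<in> carrier L"
    and cpa_add_left: "\<lbrakk>x \<in> carrier L; y \<in> carrier L; z \<in> carrier L\<rbrakk> \<Longrightarrow>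
      (x \<oplus> y) \<bullet> z = x \<bullet> z \<oplus> y \<bullet> z"
    and cpa_add_right: "\<lbrakk>x \<in> carrier L; y \<in> carrier L; z \<in> carrier L\<rbrakk> \<Longrightarrow>
      x \<bullet> (y \<oplus> z) = x \<bullet> y \<oplus> x \<bullet> z"
    and cpa_smult_left: "\<lbrakk>a \<in> carrier K; x \<in> carrier L; y \<in> carrier L\<rbrakk> \<Longrightarrow>
      (a \<odot> x) \<bullet> y = a \<odot> (x \<bullet> y)"
    and cpa_smult_right: "\<lbrakk>a \<in> carrier K; x \<in> carrier L; y \<in> carrier L\<rbrakk> \<Longrightarrow>
      x \<bullet> (a \<odot> y) = a \<odot> (x \<bullet> y)"
    and cpa_commute: "\<lbrakk>x \<in> carrier L; y \<in> carrier L\<rbrakk> \<Longrightarrow> x \<bullet> y = y \<bullet> x"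
    and cpa_bracket_left: "\<lbrakk>x \<in> carrier L; y \<in> carrier L; z \<in> carrier L\<rbrakk> \<Longrightarrow>
      \<lbrace>x, y\<rbrace> \<bullet> z = (x \<bullet> (y \<bullet> z)) \<ominus> (y \<bullet> (x \<bullet> z))"
    and cpa_bracket_right: "\<lbrakk>x \<in> carrier L; y \<in> carrier L; z \<in> carrier L\<rbrakk> \<Longrightarrow>
      x \<bullet> \<lbrace>y, z\<rbrace> = \<lbrace>x \<bullet> y, z\<rbrace> \<oplus> \<lbrace>y, x \<bullet> z\<rbrace>"

definition only_trivial_cpa :: "('k, 'c) ring_scheme \<Rightarrow> ('k, 'a, 'd) lie_algebra_scheme \<Rightarrow> bool" where
  "only_trivial_cpa K L \<longleftrightarrow>
    (\<forall>P. cpa_structure K L P \<longrightarrow> (\<forall>x\<in>carrier L. \<forall>y\<in>carrier L. P x y = \<zero>\<^bsub>L\<^esub>))"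

end

(* Tautness gives a map f with x . y = [f x, y], well defined up to the center, and commutativity reads
   [f x, y] = -[x, f y]; hence [f x, f y] = -[f (f x), y].  The homomorphism property
   x . [y, z] = [[f y, f z], x] then turns the Jacobi identity for f (f x), y, z into
   [f (f x), [y, z]] = x . [y, z], because the cyclic sum of x . [y, z] vanishes.  As the algebra is
   perfect, f (f x) and f x agree modulo the center, so [f x, f y] = -[f x, y].  The left-hand side is
   antisymmetric and the right-hand side symmetric in x and y, so 2 (x . y) = 0.

   If Out is solvable, a homomorphism into Der followed by the projection to Out maps the perfect
   algebra into every term of the derived series of Out, hence to zero. *)

theory Submission
  imports Defs
begin

section \<open>Characteristic two and additive arithmetic\<close>

text \<open>\<open>ring_char\<close> is the additive order of 1. If 1 + 1 vanished, that order would
  divide 2; order 1 would force 1 = 0, and order 2 is excluded.\<close>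

lemma (in field) one_plus_one_neq_zero:
  assumes "ring_char R \<noteq> 2"
  shows "\<one> \<oplus> \<one> \<noteq> \<zero>"
proof
  assume "\<one> \<oplus> \<one> = \<zero>"
  moreover have "\<one> [^]\<^bsub>add_monoid R\<^esub> (2::nat) = \<one> \<oplus> \<one>"
    by (simp add: numeral_2_eq_2)
  ultimately have "add.ord \<one> dvd 2"
    using add.pow_eq_id[of \<one> 2] by (simp add: add_pow_def)
  then have "add.ord \<one> = 1 \<or> add.ord \<one> = 2"
    using dvd_imp_le[of "add.ord \<one>" 2] by (cases "add.ord \<one>"; fastforce)
  then show False
    using assms add.ord_eq_1[of \<one>] by (auto simp: ring_char_def)
qed

lemma (in abelian_group) add_diff_cancel_right:
  assumes "a \<in> carrier G" "b \<in> carrier G" "c \<in> carrier G"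
  shows "(a \<oplus> c) \<ominus> (b \<oplus> c) = a \<ominus> b"
  using assms by (simp add: a_minus_def minus_add a_comm[of "\<ominus> b"] a_assoc r_neg1 r_neg2)

lemma (in abelian_group) diff_add_diff:
  assumes "a \<in> carrier G" "b \<in> carrier G" "c \<in> carrier G" "d \<in> carrier G"
  shows "(a \<ominus> b) \<oplus> (c \<ominus> d) = (a \<oplus> c) \<ominus> (b \<oplus> d)"
  using assms by (simp add: a_minus_def minus_add a_ac)

lemma (in abelian_group) diff_diff_diff:
  assumes "a \<in> carrier G" "b \<in> carrier G" "c \<in> carrier G" "d \<in> carrier G"
  shows "(a \<ominus> b) \<ominus> (c \<ominus> d) = (a \<oplus> d) \<ominus> (b \<oplus> c)"
  using assms by (simp add: a_minus_def minus_add a_ac)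

text \<open>This is the Jacobi identity for commutators of maps D, E, F: the letters
  \<open>a\<close>, ..., \<open>f\<close> stand for the values of DEF, DFE, EFD, FED, EDF, FDE, each
  of which occurs once with either sign.\<close>

lemma (in abelian_group) double_commutator_cyclic_sum:
  assumes "a \<in> carrier G" "b \<in> carrier G" "c \<in> carrier G"
    "d \<in> carrier G" "e \<in> carrier G" "f \<in> carrier G"
  shows "((a \<ominus> b) \<ominus> (c \<ominus> d)) \<oplus> ((c \<ominus> e) \<ominus> (f \<ominus> b)) \<oplus> ((f \<ominus> d) \<ominus> (a \<ominus> e)) = \<zero>"
proof -
  have "a \<oplus> d \<oplus> (c \<oplus> b) \<oplus> (f \<oplus> e) = b \<oplus> c \<oplus> (e \<oplus> f) \<oplus> (d \<oplus> a)"
    using assms by (simp add: a_ac)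
  then show ?thesis
    using assms by (simp add: diff_diff_diff diff_add_diff)
qed

section \<open>Homomorphisms of Lie algebras\<close>

lemma lie_hom_closed:
  "\<lbrakk>f \<in> lie_hom K L M; x \<in> carrier L\<rbrakk> \<Longrightarrow> f x \<in> carrier M"
  by (auto simp: lie_hom_def LinearCombinations.module_hom_def)

lemma lie_hom_add:
  "\<lbrakk>f \<in> lie_hom K L M; x \<in> carrier L; y \<in> carrier L\<rbrakk> \<Longrightarrow> f (x \<oplus>\<^bsub>L\<^esub> y) = f x \<oplus>\<^bsub>M\<^esub> f y"
  by (auto simp: lie_hom_def LinearCombinations.module_hom_def)

lemma lie_hom_smult:
  "\<lbrakk>f \<in> lie_hom K L M; a \<in> carrier K; x \<in> carrier L\<rbrakk> \<Longrightarrow> f (a \<odot>\<^bsub>L\<^esub> x) = a \<odot>\<^bsub>M\<^esub> f x"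
  by (auto simp: lie_hom_def LinearCombinations.module_hom_def)

lemma lie_hom_bracket:
  "\<lbrakk>f \<in> lie_hom K L M; x \<in> carrier L; y \<in> carrier L\<rbrakk> \<Longrightarrow> f \<lbrace>x, y\<rbrace>\<^bsub>L\<^esub> = \<lbrace>f x, f y\<rbrace>\<^bsub>M\<^esub>"
  by (auto simp: lie_hom_def)

lemmas lie_hom_simps = lie_hom_closed lie_hom_add lie_hom_smult lie_hom_bracket

lemma lie_hom_comp:
  assumes "f \<in> lie_hom K L M" "g \<in> lie_hom K M N"
  shows "g \<circ> f \<in> lie_hom K L N"
  using assms by (simp add: lie_hom_def LinearCombinations.module_hom_def Pi_iff)

section \<open>Bracket identities and perfectness\<close>

context lie_algebra
begin

lemma bracket_zero_left: "x \<in> carrier L \<Longrightarrow> \<lbrace>\<zero>, x\<rbrace> = \<zero>"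
  using bracket_smult_left[of "\<zero>\<^bsub>K\<^esub>" \<zero> x] by (simp add: bracket_closed)

lemma bracket_zero_right: "x \<in> carrier L \<Longrightarrow> \<lbrace>x, \<zero>\<rbrace> = \<zero>"
  using bracket_smult_right[of "\<zero>\<^bsub>K\<^esub>" x \<zero>] by (simp add: bracket_closed)

lemma bracket_minus_left:
  assumes "x \<in> carrier L" "y \<in> carrier L"
  shows "\<lbrace>\<ominus> x, y\<rbrace> = \<ominus> \<lbrace>x, y\<rbrace>"
  using bracket_add_left[of "\<ominus> x" x y] assms
  by (metis M.add.inv_closed M.l_neg M.minus_equality bracket_closed bracket_zero_left)

lemma bracket_minus_right:
  assumes "x \<in> carrier L" "y \<in> carrier L"
  shows "\<lbrace>x, \<ominus> y\<rbrace> = \<ominus> \<lbrace>x, y\<rbrace>"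
  using bracket_add_right[of x "\<ominus> y" y] assms
  by (metis M.add.inv_closed M.l_neg M.minus_equality bracket_closed bracket_zero_right)

lemma bracket_anticommute:
  assumes "x \<in> carrier L" "y \<in> carrier L"
  shows "\<lbrace>y, x\<rbrace> = \<ominus> \<lbrace>x, y\<rbrace>"
proof -
  have "\<zero> = \<lbrace>x \<oplus> y, x \<oplus> y\<rbrace>"
    using assms bracket_self by simp
  also have "\<dots> = \<lbrace>y, x\<rbrace> \<oplus> \<lbrace>x, y\<rbrace>"
    using assms bracket_self[of x] bracket_self[of y]
    by (simp add: bracket_add_left bracket_add_right bracket_closed)
  finally show ?thesis
    using assms by (metis M.minus_equality bracket_closed)
qed

text \<open>The Jacobi identity solved for one term, in the form that makes \<open>ad L x\<close> a
  derivation.\<close>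

lemma bracket_leibniz:
  assumes "x \<in> carrier L" "y \<in> carrier L" "z \<in> carrier L"
  shows "\<lbrace>x, \<lbrace>y, z\<rbrace>\<rbrace> = \<lbrace>\<lbrace>x, y\<rbrace>, z\<rbrace> \<oplus> \<lbrace>y, \<lbrace>x, z\<rbrace>\<rbrace>"
proof -
  have yzx: "\<lbrace>y, \<lbrace>z, x\<rbrace>\<rbrace> = \<ominus> \<lbrace>y, \<lbrace>x, z\<rbrace>\<rbrace>"
    using assms bracket_anticommute[of x z] by (simp add: bracket_minus_right bracket_closed)
  have zxy: "\<lbrace>z, \<lbrace>x, y\<rbrace>\<rbrace> = \<ominus> \<lbrace>\<lbrace>x, y\<rbrace>, z\<rbrace>"
    using assms by (intro bracket_anticommute bracket_closed)
  have c: "\<lbrace>x, \<lbrace>y, z\<rbrace>\<rbrace> \<in> carrier L" "\<lbrace>y, \<lbrace>x, z\<rbrace>\<rbrace> \<in> carrier L" "\<lbrace>\<lbrace>x, y\<rbrace>, z\<rbrace> \<in> carrier L"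
    using assms by (simp_all add: bracket_closed)
  have "\<lbrace>x, \<lbrace>y, z\<rbrace>\<rbrace> \<oplus> (\<ominus> \<lbrace>y, \<lbrace>x, z\<rbrace>\<rbrace> \<oplus> \<ominus> \<lbrace>\<lbrace>x, y\<rbrace>, z\<rbrace>) = \<zero>"
    using jacobi[OF assms] c unfolding yzx zxy by (simp add: M.a_assoc)
  then have "\<lbrace>x, \<lbrace>y, z\<rbrace>\<rbrace> = \<ominus> (\<ominus> \<lbrace>y, \<lbrace>x, z\<rbrace>\<rbrace> \<oplus> \<ominus> \<lbrace>\<lbrace>x, y\<rbrace>, z\<rbrace>)"
    using c M.minus_equality by (metis M.add.inv_closed M.add.m_closed)
  then show ?thesis
    using c by (simp add: M.minus_add M.a_comm)
qed

text \<open>The brackets span a perfect algebra, so a linear condition need only be tested on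
  them.\<close>

lemma perfect_induct:
  assumes "perfect K L" and "submodule K N L"
    and "\<And>x y. \<lbrakk>x \<in> carrier L; y \<in> carrier L\<rbrakk> \<Longrightarrow> \<lbrace>x, y\<rbrace> \<in> N"
  shows "carrier L \<subseteq> N"
proof -
  have "span {\<lbrace>x, y\<rbrace> | x y. x \<in> carrier L \<and> y \<in> carrier L} \<subseteq> N"
    using assms(2,3) by (intro span_is_subset) auto
  then show ?thesis
    using assms(1) by (simp add: perfect_def bracket_span_def)
qed

text \<open>The elements \<open>w\<close> with equal brackets form a submodule, to which
  \<open>perfect_induct\<close> applies. Thus two elements that act alike on all brackets differ by
  a central element.\<close>

lemma perfect_bracket_eq:
  assumes "perfect K L" and "a \<in> carrier L" "b \<in> carrier L"
    and eq: "\<And>y z. \<lbrakk>y \<in> carrier L; z \<in> carrier L\<rbrakk> \<Longrightarrow> \<lbrace>a, \<lbrace>y, z\<rbrace>\<rbrace> = \<lbrace>b, \<lbrace>y, z\<rbrace>\<rbrace>"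
    and "w \<in> carrier L"
  shows "\<lbrace>a, w\<rbrace> = \<lbrace>b, w\<rbrace>"
proof -
  have "submodule K {w \<in> carrier L. \<lbrace>a, w\<rbrace> = \<lbrace>b, w\<rbrace>} L"
    using assms(2,3)
    by (intro submodule.intro module_axioms)
      (auto simp: bracket_add_right bracket_smult_right bracket_zero_right)
  then have "carrier L \<subseteq> {w \<in> carrier L. \<lbrace>a, w\<rbrace> = \<lbrace>b, w\<rbrace>}"
    by (rule perfect_induct[OF assms(1)]) (simp add: eq bracket_closed)
  with \<open>w \<in> carrier L\<close> show ?thesis by auto
qed

lemma derived_series_subset: "derived_series K L n \<subseteq> carrier L"
proof (induction n)
  case (Suc n)
  then show ?case
    unfolding derived_series.simps bracket_span_def
    by (intro span_is_subset2) (auto intro: bracket_closed)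
qed simp

end

section \<open>Homomorphic images\<close>

text \<open>Induction on \<open>n\<close>: if all values lie in one derived term, then brackets of
  the source go to brackets of that term. The preimage of the next term is therefore a submodule
  containing all brackets, hence everything.\<close>

lemma lie_hom_perfect_derived_series:
  assumes "lie_algebra K L" "lie_algebra K M" "perfect K L" and f: "f \<in> lie_hom K L M"
  shows "f ` carrier L \<subseteq> derived_series K M n"
proof -
  interpret L: lie_algebra K L by fact
  interpret M: lie_algebra K M by fact
  show ?thesis
  proof (induction n)
    case (Suc n)
    let ?D = "derived_series K M n"
    let ?S = "{\<lbrace>x, y\<rbrace>\<^bsub>M\<^esub> | x y. x \<in> ?D \<and> y \<in> ?D}"
    have S: "?S \<subseteq> carrier M"
      using M.derived_series_subset by (auto intro!: M.bracket_closed)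
    interpret N: submodule K "M.span ?S" M
      using S by (rule M.span_is_submodule)
    \<comment> \<open>Preservation of zero is not part of \<open>lie_hom\<close>; it comes from
      compatibility with the scalar 0.\<close>
    have "f \<zero>\<^bsub>L\<^esub> = \<zero>\<^bsub>M\<^esub>"
      using lie_hom_smult[OF f, of "\<zero>\<^bsub>K\<^esub>" "\<zero>\<^bsub>L\<^esub>"] lie_hom_closed[OF f] by simp
    then have "submodule K {x \<in> carrier L. f x \<in> M.span ?S} L"
      using f by (intro submodule.intro L.module_axioms) (auto simp: lie_hom_simps)
    then have "carrier L \<subseteq> {x \<in> carrier L. f x \<in> M.span ?S}"
      using Suc.IH M.in_own_span[OF S] f
      by (intro L.perfect_induct assms(3)) (fastforce simp: lie_hom_bracket L.bracket_closed)+
    then show ?case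
      by (auto simp: bracket_span_def)
  qed (use f in \<open>auto simp: lie_hom_closed\<close>)
qed

text \<open>Transport of structure: \<open>M\<close> is so far only a record, and each axiom for it
  is the image of the same axiom for \<open>L\<close>. Its zero is a separate field, so it has to be
  tied to \<open>f\<close> by an assumption. This spares checking axioms on cosets.\<close>

lemma lie_algebra_hom_image:
  assumes "lie_algebra K L" and f: "f \<in> lie_hom K L M"
    and onto: "carrier M = f ` carrier L" and zero: "\<zero>\<^bsub>M\<^esub> = f \<zero>\<^bsub>L\<^esub>"
  shows "lie_algebra K M"
proof -
  interpret L: lie_algebra K L by fact
  note s = lie_hom_add[OF f, symmetric] lie_hom_smult[OF f, symmetric]
    lie_hom_bracket[OF f, symmetric]
  have "abelian_group M"
  proof (rule abelian_groupI)
    fix x assume "x \<in> carrier M"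
    then obtain a where "a \<in> carrier L" "x = f a" using onto by auto
    then show "\<exists>y\<in>carrier M. y \<oplus>\<^bsub>M\<^esub> x = \<zero>\<^bsub>M\<^esub>"
      by (intro bexI[of _ "f (\<ominus>\<^bsub>L\<^esub> a)"]) (auto simp: s zero onto L.M.l_neg)
  qed (auto simp: onto zero s L.M.add.m_ac)
  then have "Module.module K M"
    by (intro moduleI)
      (auto simp: onto zero s L.smult_l_distr L.smult_r_distr L.smult_assoc1 L.R.cring_axioms)
  then show ?thesis
    by (intro lie_algebra.intro vectorspace.intro lie_algebra_axioms.intro L.field_axioms)
      (auto simp: onto zero s L.bracket_closed L.bracket_add_left L.bracket_add_right
        L.bracket_smult_left L.bracket_smult_right L.bracket_self L.jacobi)
qed

section \<open>Ideals and quotients\<close>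

text \<open>Brackets are asked for with the ideal element on the right only; the other side follows
  by anticommutativity.\<close>

locale lie_ideal = lie_algebra K L
  for K :: "('k, 'c) ring_scheme" and I and L :: "('k, 'a, 'd) lie_algebra_scheme" (structure) +
  assumes ideal_submodule: "submodule K I L"
    and ideal_bracket: "\<lbrakk>x \<in> carrier L; i \<in> I\<rbrakk> \<Longrightarrow> \<lbrace>x, i\<rbrace> \<in> I"
begin

sublocale I: submodule K I L
  by (rule ideal_submodule)

sublocale cosets: abelian_subgroup I L
proof (rule abelian_subgroupI3)
  \<comment> \<open>Negatives are obtained as multiples by the scalar -1.\<close>
  have "\<ominus> x \<in> I" if "x \<in> I" for x
    using that I.smult_closed[of "\<ominus>\<^bsub>K\<^esub> \<one>\<^bsub>K\<^esub>" x] I.subset smult_minus_1[of x]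
    by (metis R.add.inv_closed R.one_closed subsetD)
  then show "additive_subgroup I L"
    by (intro additive_subgroup.intro M.add.subgroupI)
      (use I.subset I.zero_closed in \<open>auto simp: a_inv_def simp del: I.zero_closed\<close>)
qed (rule M.abelian_group_axioms)

lemma coset_eqI:
  assumes "x \<in> carrier L" "i \<in> I"
  shows "I +> (i \<oplus> x) = I +> x"
  using assms
  by (intro cosets.a_repr_independence'[symmetric]) (auto simp: a_r_coset_def')

text \<open>The operations of \<open>lie_quot\<close> are unions over all representatives.
  Independence of the representative makes every set in such a union the same coset, and since
  cosets are nonempty the union is that coset.\<close>

lemma lie_quot_hom: "(\<lambda>x. I +> x) \<in> lie_hom K L (lie_quot L I)"
proof -
  have smult: "(\<Union>b\<in>I +> x. I +> (a \<odot> b)) = I +> (a \<odot> x)"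
    if "a \<in> carrier K" "x \<in> carrier L" for a x
  proof -
    have "I +> (a \<odot> b) = I +> (a \<odot> x)" if "b \<in> I +> x" for b
    proof -
      obtain i where "i \<in> I" "b = i \<oplus> x"
        using \<open>b \<in> I +> x\<close> by (auto simp: a_r_coset_def')
      then show ?thesis
        using \<open>a \<in> carrier K\<close> \<open>x \<in> carrier L\<close> by (simp add: smult_r_distr coset_eqI)
    qed
    moreover have "I +> x \<noteq> {}"
      using that cosets.a_rcos_self by blast
    ultimately show ?thesis by simp
  qed
  have bracket: "(\<Union>a\<in>I +> x. \<Union>b\<in>I +> y. I +> \<lbrace>a, b\<rbrace>) = I +> \<lbrace>x, y\<rbrace>"
    if "x \<in> carrier L" "y \<in> carrier L" for x y
  proof -
    have "I +> \<lbrace>a, b\<rbrace> = I +> \<lbrace>x, y\<rbrace>" if "a \<in> I +> x" "b \<in> I +> y" for a b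
    proof -
      have "\<exists>i\<in>I. a = i \<oplus> x" "\<exists>j\<in>I. b = j \<oplus> y"
        using that by (auto simp: a_r_coset_def')
      then obtain i j where ij: "i \<in> I" "a = i \<oplus> x" "j \<in> I" "b = j \<oplus> y"
        by blast
      have "\<lbrace>i, b\<rbrace> = \<ominus> \<lbrace>b, i\<rbrace>"
        using ij \<open>y \<in> carrier L\<close> by (intro bracket_anticommute) auto
      then have "\<lbrace>i, b\<rbrace> \<in> I"
        using ij \<open>y \<in> carrier L\<close> by (simp add: ideal_bracket)
      \<comment> \<open>The first two summands lie in \<open>I\<close>, so the coset is that of the
        third.\<close>
      moreover have "\<lbrace>a, b\<rbrace> = \<lbrace>i, b\<rbrace> \<oplus> (\<lbrace>x, j\<rbrace> \<oplus> \<lbrace>x, y\<rbrace>)"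
        using ij \<open>x \<in> carrier L\<close> \<open>y \<in> carrier L\<close>
        by (simp add: bracket_add_left bracket_add_right bracket_closed M.add.m_ac)
      ultimately show ?thesis
        using ij \<open>x \<in> carrier L\<close> \<open>y \<in> carrier L\<close>
        by (simp add: coset_eqI ideal_bracket bracket_closed)
    qed
    moreover have "I +> x \<noteq> {}" "I +> y \<noteq> {}"
      using that cosets.a_rcos_self by blast+
    ultimately show ?thesis by simp
  qed
  show ?thesis
    using cosets.a_subset
    by (simp add: lie_hom_def LinearCombinations.module_hom_def lie_quot_def smult bracket cosets.a_rcos_sum
        M.a_rcosetsI)
qed

lemma lie_quot_lie_algebra: "lie_algebra K (lie_quot L I)"
  by (rule lie_algebra_hom_image[OF lie_algebra_axioms lie_quot_hom])
    (auto simp: lie_quot_def A_RCOSETS_def' cosets.a_rcos_const)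

lemma coset_eq_ideal_iff:
  "x \<in> carrier L \<Longrightarrow> I +> x = I \<longleftrightarrow> x \<in> I"
  using cosets.a_rcos_self cosets.a_rcos_const by blast

end


section \<open>Derivations, inner derivations and tautness\<close>

context lie_algebra
begin

lemma derivationsI:
  assumes "D \<in> extensional (carrier L)" "\<And>x. x \<in> carrier L \<Longrightarrow> D x \<in> carrier L"
    and "\<And>x y. \<lbrakk>x \<in> carrier L; y \<in> carrier L\<rbrakk> \<Longrightarrow> D (x \<oplus> y) = D x \<oplus> D y"
    and "\<And>a x. \<lbrakk>a \<in> carrier K; x \<in> carrier L\<rbrakk> \<Longrightarrow> D (a \<odot> x) = a \<odot> D x"
    and "\<And>x y. \<lbrakk>x \<in> carrier L; y \<in> carrier L\<rbrakk> \<Longrightarrow> D \<lbrace>x, y\<rbrace> = \<lbrace>D x, y\<rbrace> \<oplus> \<lbrace>x, D y\<rbrace>"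
  shows "D \<in> derivations K L"
  using assms by (simp add: derivations_def LinearCombinations.module_hom_def)

lemma derivations_extensional: "D \<in> derivations K L \<Longrightarrow> D \<in> extensional (carrier L)"
  and derivations_closed: "\<lbrakk>D \<in> derivations K L; x \<in> carrier L\<rbrakk> \<Longrightarrow> D x \<in> carrier L"
  and derivations_add:
    "\<lbrakk>D \<in> derivations K L; x \<in> carrier L; y \<in> carrier L\<rbrakk> \<Longrightarrow> D (x \<oplus> y) = D x \<oplus> D y"
  and derivations_smult:
    "\<lbrakk>D \<in> derivations K L; a \<in> carrier K; x \<in> carrier L\<rbrakk> \<Longrightarrow> D (a \<odot> x) = a \<odot> D x"
  and derivations_bracket:
    "\<lbrakk>D \<in> derivations K L; x \<in> carrier L; y \<in> carrier L\<rbrakk> \<Longrightarrow>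
      D \<lbrace>x, y\<rbrace> = \<lbrace>D x, y\<rbrace> \<oplus> \<lbrace>x, D y\<rbrace>"
  by (auto simp: derivations_def LinearCombinations.module_hom_def)

lemma derivations_minus:
  assumes "D \<in> derivations K L" "x \<in> carrier L"
  shows "D (\<ominus> x) = \<ominus> D x"
  using assms derivations_smult[of D "\<ominus>\<^bsub>K\<^esub> \<one>\<^bsub>K\<^esub>" x]
  by (simp add: smult_minus_1 derivations_closed)

lemma derivations_diff:
  assumes "D \<in> derivations K L" "x \<in> carrier L" "y \<in> carrier L"
  shows "D (x \<ominus> y) = D x \<ominus> D y"
  using assms by (simp add: a_minus_def derivations_add derivations_minus)

lemmas derivations_simps =
  derivations_closed derivations_add derivations_smult derivations_bracket derivations_minus
  derivations_diff

lemma Der_simps: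
  "carrier (Der K L) = derivations K L"
  "\<zero>\<^bsub>Der K L\<^esub> = (\<lambda>x\<in>carrier L. \<zero>)"
  "D \<oplus>\<^bsub>Der K L\<^esub> E = (\<lambda>x\<in>carrier L. D x \<oplus> E x)"
  "a \<odot>\<^bsub>Der K L\<^esub> D = (\<lambda>x\<in>carrier L. a \<odot> D x)"
  "\<lbrace>D, E\<rbrace>\<^bsub>Der K L\<^esub> = (\<lambda>x\<in>carrier L. D (E x) \<ominus> E (D x))"
  by (simp_all add: Der_def)

lemma derivation_eqI:
  assumes "D \<in> extensional (carrier L)" "E \<in> extensional (carrier L)"
    and "\<And>x. x \<in> carrier L \<Longrightarrow> D x = E x"
  shows "D = E"
  using assms by (rule extensionalityI)

lemma Der_zero_closed: "(\<lambda>x\<in>carrier L. \<zero>) \<in> derivations K L"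
  by (rule derivationsI) (auto simp: bracket_closed bracket_zero_left bracket_zero_right)

lemma Der_add_closed:
  assumes "D \<in> derivations K L" "E \<in> derivations K L"
  shows "(\<lambda>x\<in>carrier L. D x \<oplus> E x) \<in> derivations K L"
  using assms
  by (intro derivationsI)
    (simp_all add: derivations_simps bracket_closed bracket_add_left bracket_add_right
      smult_r_distr M.add.m_ac)

lemma Der_smult_closed:
  assumes "a \<in> carrier K" "D \<in> derivations K L"
  shows "(\<lambda>x\<in>carrier L. a \<odot> D x) \<in> derivations K L"
  using assms
  by (intro derivationsI)
    (simp_all add: derivations_simps bracket_closed bracket_smult_left bracket_smult_right
      smult_r_distr smult_assoc1[symmetric] R.m_comm)

lemma Der_bracket_closed:
  assumes "D \<in> derivations K L" "E \<in> derivations K L"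
  shows "(\<lambda>x\<in>carrier L. D (E x) \<ominus> E (D x)) \<in> derivations K L"
proof (rule derivationsI)
  fix x y assume xy: "x \<in> carrier L" "y \<in> carrier L"
  note c = assms xy derivations_simps bracket_closed bracket_add_left bracket_add_right M.add.m_ac
  \<comment> \<open>The mixed terms are the same for DE and ED and cancel in the commutator.\<close>
  let ?s = "\<lbrace>D x, E y\<rbrace> \<oplus> \<lbrace>E x, D y\<rbrace>"
  have "D (E \<lbrace>x, y\<rbrace>) = (\<lbrace>D (E x), y\<rbrace> \<oplus> \<lbrace>x, D (E y)\<rbrace>) \<oplus> ?s"
    and "E (D \<lbrace>x, y\<rbrace>) = (\<lbrace>E (D x), y\<rbrace> \<oplus> \<lbrace>x, E (D y)\<rbrace>) \<oplus> ?s"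
    by (simp_all add: c)
  then have "D (E \<lbrace>x, y\<rbrace>) \<ominus> E (D \<lbrace>x, y\<rbrace>) =
      (\<lbrace>D (E x), y\<rbrace> \<oplus> \<lbrace>x, D (E y)\<rbrace>) \<ominus> (\<lbrace>E (D x), y\<rbrace> \<oplus> \<lbrace>x, E (D y)\<rbrace>)"
    using assms xy by (simp add: M.add_diff_cancel_right derivations_closed bracket_closed)
  then show "(\<lambda>x\<in>carrier L. D (E x) \<ominus> E (D x)) \<lbrace>x, y\<rbrace> =
      \<lbrace>(\<lambda>x\<in>carrier L. D (E x) \<ominus> E (D x)) x, y\<rbrace> \<oplus>
      \<lbrace>x, (\<lambda>x\<in>carrier L. D (E x) \<ominus> E (D x)) y\<rbrace>"
    using xy by (simp add: c a_minus_def M.minus_add bracket_minus_left bracket_minus_right)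
qed (use assms in \<open>simp_all add: derivations_simps a_minus_def smult_r_distr smult_r_minus M.minus_add M.add.m_ac\<close>)

lemma Der_lie_algebra: "lie_algebra K (Der K L)"
proof -
  note s = Der_simps Der_zero_closed Der_add_closed Der_smult_closed Der_bracket_closed
    derivations_simps
  have ag: "abelian_group (Der K L)"
  proof (rule abelian_groupI)
    fix D assume D: "D \<in> carrier (Der K L)"
    \<comment> \<open>The additive inverse is written as a scalar multiple, so that its membership
      follows from \<open>Der_smult_closed\<close>.\<close>
    let ?E = "(\<ominus>\<^bsub>K\<^esub> \<one>\<^bsub>K\<^esub>) \<odot>\<^bsub>Der K L\<^esub> D"
    have "?E \<oplus>\<^bsub>Der K L\<^esub> D = \<zero>\<^bsub>Der K L\<^esub>"
      using D by (auto simp: s smult_minus_1 M.l_neg cong: restrict_cong)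
    moreover have "?E \<in> carrier (Der K L)"
      using D Der_smult_closed[of "\<ominus>\<^bsub>K\<^esub> \<one>\<^bsub>K\<^esub>" D] by (simp add: Der_simps)
    ultimately show "\<exists>E\<in>carrier (Der K L). E \<oplus>\<^bsub>Der K L\<^esub> D = \<zero>\<^bsub>Der K L\<^esub>"
      by blast
  qed (auto simp: s M.add.m_ac derivations_extensional intro!: derivation_eqI)
  have "Module.module K (Der K L)"
    by (intro moduleI ag R.cring_axioms)
      (auto simp: s smult_l_distr smult_r_distr smult_assoc1 derivations_extensional
        intro!: derivation_eqI)
  then have vs: "vectorspace K (Der K L)"
    by (intro vectorspace.intro field_axioms)
  show ?thesis
  proof (intro lie_algebra.intro vs lie_algebra_axioms.intro)
    fix D E F
    assume "D \<in> carrier (Der K L)" "E \<in> carrier (Der K L)" "F \<in> carrier (Der K L)"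
    then have DEF: "D \<in> derivations K L" "E \<in> derivations K L" "F \<in> derivations K L"
      by (simp_all add: Der_simps)
    show "\<lbrace>D, E\<rbrace>\<^bsub>Der K L\<^esub> \<in> carrier (Der K L)"
      using DEF by (simp add: Der_simps Der_bracket_closed)
    show "\<lbrace>D \<oplus>\<^bsub>Der K L\<^esub> E, F\<rbrace>\<^bsub>Der K L\<^esub> = \<lbrace>D, F\<rbrace>\<^bsub>Der K L\<^esub> \<oplus>\<^bsub>Der K L\<^esub> \<lbrace>E, F\<rbrace>\<^bsub>Der K L\<^esub>"
      and "\<lbrace>D, E \<oplus>\<^bsub>Der K L\<^esub> F\<rbrace>\<^bsub>Der K L\<^esub> = \<lbrace>D, E\<rbrace>\<^bsub>Der K L\<^esub> \<oplus>\<^bsub>Der K L\<^esub> \<lbrace>D, F\<rbrace>\<^bsub>Der K L\<^esub>"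
      using DEF by (auto simp: Der_simps derivations_simps M.diff_add_diff intro!: derivation_eqI)
    show "\<lbrace>a \<odot>\<^bsub>Der K L\<^esub> D, E\<rbrace>\<^bsub>Der K L\<^esub> = a \<odot>\<^bsub>Der K L\<^esub> \<lbrace>D, E\<rbrace>\<^bsub>Der K L\<^esub>"
      and "\<lbrace>D, a \<odot>\<^bsub>Der K L\<^esub> E\<rbrace>\<^bsub>Der K L\<^esub> = a \<odot>\<^bsub>Der K L\<^esub> \<lbrace>D, E\<rbrace>\<^bsub>Der K L\<^esub>"
      if "a \<in> carrier K" for a
      using DEF that
      by (auto simp: Der_simps derivations_simps a_minus_def smult_r_distr smult_r_minus
          intro!: derivation_eqI)
    show "\<lbrace>D, D\<rbrace>\<^bsub>Der K L\<^esub> = \<zero>\<^bsub>Der K L\<^esub>"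
      using DEF
      by (auto simp: Der_simps derivations_closed a_minus_def M.r_neg intro!: derivation_eqI)
    show "\<lbrace>D, \<lbrace>E, F\<rbrace>\<^bsub>Der K L\<^esub>\<rbrace>\<^bsub>Der K L\<^esub> \<oplus>\<^bsub>Der K L\<^esub> \<lbrace>E, \<lbrace>F, D\<rbrace>\<^bsub>Der K L\<^esub>\<rbrace>\<^bsub>Der K L\<^esub>
        \<oplus>\<^bsub>Der K L\<^esub> \<lbrace>F, \<lbrace>D, E\<rbrace>\<^bsub>Der K L\<^esub>\<rbrace>\<^bsub>Der K L\<^esub> = \<zero>\<^bsub>Der K L\<^esub>"
      using DEF
      by (auto simp: Der_simps derivations_simps M.double_commutator_cyclic_sum
          intro!: derivation_eqI)
  qed
qed

lemma ad_derivation: "x \<in> carrier L \<Longrightarrow> ad L x \<in> derivations K L"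
  unfolding ad_def
  by (intro derivationsI)
    (simp_all add: bracket_closed bracket_add_right bracket_smult_right bracket_leibniz[of x])

text \<open>The product rule gives D[x, y] - [x, D y] = [D x, y]. This is why the inner derivations
  form an ideal.\<close>

lemma Der_bracket_ad:
  assumes "D \<in> derivations K L" "x \<in> carrier L"
  shows "\<lbrace>D, ad L x\<rbrace>\<^bsub>Der K L\<^esub> = ad L (D x)"
  using assms
  by (intro derivation_eqI)
    (simp_all add: ad_def Der_simps derivations_simps bracket_closed a_minus_def
      M.a_assoc M.r_neg)

lemma Inn_lie_ideal: "lie_ideal K (Inn L) (Der K L)"
proof -
  interpret Der: lie_algebra K "Der K L"
    by (rule Der_lie_algebra)
  have "ad L x \<oplus>\<^bsub>Der K L\<^esub> ad L y = ad L (x \<oplus> y)" if "x \<in> carrier L" "y \<in> carrier L" for x y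
    using that by (auto simp: ad_def Der_simps bracket_add_left intro!: derivation_eqI)
  moreover have "a \<odot>\<^bsub>Der K L\<^esub> ad L x = ad L (a \<odot> x)" if "a \<in> carrier K" "x \<in> carrier L" for a x
    using that by (auto simp: ad_def Der_simps bracket_smult_left intro!: derivation_eqI)
  moreover have "\<zero>\<^bsub>Der K L\<^esub> = ad L \<zero>"
    by (auto simp: ad_def Der_simps bracket_zero_left intro!: derivation_eqI)
  ultimately have "submodule K (Inn L) (Der K L)"
    by (intro submodule.intro Der.module_axioms)
      (auto simp: Inn_def Der_simps(1) ad_derivation)
  then show ?thesis
    by (intro lie_ideal.intro lie_ideal_axioms.intro Der_lie_algebra)
      (auto simp: Inn_def Der_simps(1) Der_bracket_ad derivations_closed)
qed

text \<open>Reduces the solvable case to the taut one: a value of \<open>\<phi>\<close> is inner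
  exactly when its class in \<open>Out K L\<close> is zero.\<close>

lemma solvable_Out_imp_taut:
  assumes "perfect K L" and "lie_solvable K (Out K L)"
  shows "taut K L"
  unfolding taut_def
proof (intro ballI subsetI; elim imageE)
  fix \<phi> x D
  assume \<phi>: "\<phi> \<in> lie_hom K L (Der K L)" and x: "x \<in> carrier L" and D: "D = \<phi> x"
  interpret Inn: lie_ideal K "Inn L" "Der K L"
    by (rule Inn_lie_ideal)
  obtain n where "derived_series K (Out K L) n = {\<zero>\<^bsub>Out K L\<^esub>}"
    using assms(2) by (auto simp: lie_solvable_def)
  moreover have "((\<lambda>D. Inn L +>\<^bsub>Der K L\<^esub> D) \<circ> \<phi>) ` carrier L \<subseteq> derived_series K (Out K L) n"
    unfolding Out_def
    by (intro lie_hom_perfect_derived_series lie_algebra_axioms Inn.lie_quot_lie_algebra assms(1)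
        lie_hom_comp[OF \<phi>] Inn.lie_quot_hom)
  \<comment> \<open>The zero of the quotient is the ideal itself, viewed as a coset.\<close>
  ultimately have "Inn L +>\<^bsub>Der K L\<^esub> \<phi> x = Inn L"
    using x by (auto simp: Out_def lie_quot_def)
  then show "D \<in> Inn L"
    using D x \<phi> by (simp add: Inn.coset_eq_ideal_iff lie_hom_closed)
qed

end

section \<open>CPA-structures given by inner derivations\<close>

context cpa_structure
begin

text \<open>\<open>cpa_bracket_right\<close> makes each left multiplication a derivation, and
  \<open>cpa_bracket_left\<close> makes the assignment respect brackets.\<close>

lemma left_mult_lie_hom: "(\<lambda>x. \<lambda>y\<in>carrier L. x \<bullet> y) \<in> lie_hom K L (Der K L)"
proof -
  have "(\<lambda>y\<in>carrier L. x \<bullet> y) \<in> derivations K L" if "x \<in> carrier L" for x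
    using that
    by (intro derivationsI)
      (simp_all add: cpa_closed cpa_add_right cpa_smult_right cpa_bracket_right bracket_closed)
  then show ?thesis
    by (auto simp: lie_hom_def LinearCombinations.module_hom_def Der_simps cpa_closed bracket_closed
        cpa_add_left cpa_smult_left cpa_bracket_left intro!: derivation_eqI)
qed

text \<open>The map \<open>f\<close> is a pointwise choice, with values fixed only up to the center;
  hence neither linearity nor compatibility with brackets is claimed for it.\<close>

lemma taut_imp_inner:
  assumes "taut K L"
  obtains f where "\<And>x. x \<in> carrier L \<Longrightarrow> f x \<in> carrier L"
    and "\<And>x y. \<lbrakk>x \<in> carrier L; y \<in> carrier L\<rbrakk> \<Longrightarrow> x \<bullet> y = \<lbrace>f x, y\<rbrace>"
proof -
  have "\<forall>x\<in>carrier L. \<exists>a\<in>carrier L. (\<lambda>y\<in>carrier L. x \<bullet> y) = ad L a"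
    using assms left_mult_lie_hom by (fastforce simp: taut_def Inn_def)
  then obtain f where f: "\<And>x. x \<in> carrier L \<Longrightarrow> f x \<in> carrier L"
      "\<And>x. x \<in> carrier L \<Longrightarrow> (\<lambda>y\<in>carrier L. x \<bullet> y) = ad L (f x)"
    by metis
  have "x \<bullet> y = \<lbrace>f x, y\<rbrace>" if "x \<in> carrier L" "y \<in> carrier L" for x y
    using fun_cong[OF f(2), of x y] that by (simp add: ad_def)
  with f(1) show ?thesis by (rule that)
qed

text \<open>By commutativity and \<open>cpa_bracket_left\<close>, each summand is a difference of
  two consecutive terms in the cycle y(zx), z(xy), x(yz), so the sum telescopes.\<close>

lemma cyclic_sum_eq_zero:
  assumes "x \<in> carrier L" "y \<in> carrier L" "z \<in> carrier L"
  shows "x \<bullet> \<lbrace>y, z\<rbrace> \<oplus> (y \<bullet> \<lbrace>z, x\<rbrace> \<oplus> z \<bullet> \<lbrace>x, y\<rbrace>) = \<zero>"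
proof -
  have *: "a \<bullet> \<lbrace>b, c\<rbrace> = b \<bullet> (c \<bullet> a) \<oplus> \<ominus> (c \<bullet> (a \<bullet> b))"
    if "a \<in> carrier L" "b \<in> carrier L" "c \<in> carrier L" for a b c
    using that cpa_commute[of a "\<lbrace>b, c\<rbrace>"] cpa_commute[of b a]
    by (simp add: cpa_bracket_left bracket_closed a_minus_def)
  show ?thesis
    using assms by (simp add: * cpa_closed M.add.m_ac M.r_neg M.r_neg1 M.r_neg2)
qed

lemma inner_imp_trivial:
  assumes "perfect K L" and two: "\<one>\<^bsub>K\<^esub> \<oplus>\<^bsub>K\<^esub> \<one>\<^bsub>K\<^esub> \<noteq> \<zero>\<^bsub>K\<^esub>"
    and f: "\<And>x. x \<in> carrier L \<Longrightarrow> f x \<in> carrier L"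
    and inner: "\<And>x y. \<lbrakk>x \<in> carrier L; y \<in> carrier L\<rbrakk> \<Longrightarrow> x \<bullet> y = \<lbrace>f x, y\<rbrace>"
    and "x \<in> carrier L" "y \<in> carrier L"
  shows "x \<bullet> y = \<zero>"
proof -
  have comm: "\<lbrace>f x, y\<rbrace> = \<lbrace>f y, x\<rbrace>" if "x \<in> carrier L" "y \<in> carrier L" for x y
    using that cpa_commute inner by metis
  \<comment> \<open>This is \<open>comm\<close> for the pair \<open>f x\<close>, \<open>y\<close>,
    followed by anticommutativity.\<close>
  have ff: "\<lbrace>f x, f y\<rbrace> = \<ominus> \<lbrace>f (f x), y\<rbrace>" if "x \<in> carrier L" "y \<in> carrier L" for x y
    using that f bracket_anticommute[of "f y" "f x"] comm[of "f x" y] by simp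
  \<comment> \<open>The left side is also the bracket of \<open>f\<close> at [y, z] with
    \<open>x\<close>, so this says that \<open>f\<close> respects brackets modulo the
    center.\<close>
  have hom: "x \<bullet> \<lbrace>y, z\<rbrace> = \<lbrace>\<lbrace>f y, f z\<rbrace>, x\<rbrace>"
    if "x \<in> carrier L" "y \<in> carrier L" "z \<in> carrier L" for x y z
  proof -
    have "x \<bullet> \<lbrace>y, z\<rbrace> = \<lbrace>y, z\<rbrace> \<bullet> x"
      using that by (simp add: cpa_commute bracket_closed)
    also have "\<dots> = y \<bullet> (z \<bullet> x) \<ominus> z \<bullet> (y \<bullet> x)"
      using that by (simp add: cpa_bracket_left)
    also have "\<dots> = \<lbrace>f y, \<lbrace>f z, x\<rbrace>\<rbrace> \<ominus> \<lbrace>f z, \<lbrace>f y, x\<rbrace>\<rbrace>"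
      using that f by (simp add: inner bracket_closed)
    also have "\<dots> = \<lbrace>\<lbrace>f y, f z\<rbrace>, x\<rbrace>"
      using that f bracket_leibniz[of "f y" "f z" x]
      by (simp add: bracket_closed a_minus_def M.a_assoc M.r_neg)
    finally show ?thesis .
  qed
  have ff_bracket: "\<lbrace>f (f x), \<lbrace>y, z\<rbrace>\<rbrace> = \<lbrace>f x, \<lbrace>y, z\<rbrace>\<rbrace>"
    if xyz: "x \<in> carrier L" "y \<in> carrier L" "z \<in> carrier L" for x y z
  proof -
    \<comment> \<open>\<open>ff\<close> trades the inner bracket for -[f x, f y], and
      \<open>hom\<close> reads the result as a product. The same is then done with \<open>y\<close>
      and \<open>z\<close> exchanged, which covers both terms of the Leibniz expansion
      below.\<close>
    have z: "\<lbrace>\<lbrace>f (f x), y\<rbrace>, z\<rbrace> = \<ominus> (z \<bullet> \<lbrace>x, y\<rbrace>)"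
      using xyz f by (simp add: hom ff bracket_minus_left bracket_closed)
    have "y \<bullet> \<lbrace>z, x\<rbrace> = \<lbrace>\<lbrace>f (f x), z\<rbrace>, y\<rbrace>"
      using xyz f bracket_anticommute[of "f x" "f z"]
      by (simp add: hom ff bracket_minus_left bracket_closed)
    then have y: "\<lbrace>y, \<lbrace>f (f x), z\<rbrace>\<rbrace> = \<ominus> (y \<bullet> \<lbrace>z, x\<rbrace>)"
      using xyz f bracket_anticommute[of "\<lbrace>f (f x), z\<rbrace>" y] by (simp add: bracket_closed)
    have "\<lbrace>f (f x), \<lbrace>y, z\<rbrace>\<rbrace> = \<ominus> (y \<bullet> \<lbrace>z, x\<rbrace> \<oplus> z \<bullet> \<lbrace>x, y\<rbrace>)"
      using xyz f bracket_leibniz[of "f (f x)" y z]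
      by (simp add: y z cpa_closed bracket_closed M.minus_add M.a_comm)
    also have "\<dots> = x \<bullet> \<lbrace>y, z\<rbrace>"
      using xyz cyclic_sum_eq_zero by (intro M.minus_equality) (auto simp: cpa_closed bracket_closed)
    finally show ?thesis
      using xyz by (simp add: inner bracket_closed)
  qed
  \<comment> \<open>Perfectness extends \<open>ff_bracket\<close> from brackets to all
    elements.\<close>
  have idem: "\<lbrace>f (f x), y\<rbrace> = \<lbrace>f x, y\<rbrace>" if "x \<in> carrier L" "y \<in> carrier L" for x y
    by (rule perfect_bracket_eq[OF assms(1)]) (use that f ff_bracket in auto)
  let ?v = "\<lbrace>f x, y\<rbrace>"
  have v: "?v \<in> carrier L"
    using assms(5,6) f by (simp add: bracket_closed)
  \<comment> \<open>\<open>?v\<close> is symmetric in \<open>x\<close> and \<open>y\<close> by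
    \<open>comm\<close>, so both orders of the bracket give the same value, while anticommutativity
    makes them opposite.\<close>
  have "\<lbrace>f x, f y\<rbrace> = \<ominus> ?v" "\<lbrace>f y, f x\<rbrace> = \<ominus> ?v"
    using assms(5,6) by (simp_all add: ff idem comm)
  then have neg: "?v = \<ominus> ?v"
    using assms(5,6) f v bracket_anticommute[of "f x" "f y"] by simp
  have "(\<one>\<^bsub>K\<^esub> \<oplus>\<^bsub>K\<^esub> \<one>\<^bsub>K\<^esub>) \<odot> ?v = ?v \<oplus> ?v"
    using v by (simp add: smult_l_distr)
  also have "\<dots> = ?v \<oplus> \<ominus> ?v"
    using neg by (rule arg_cong)
  finally have "(\<one>\<^bsub>K\<^esub> \<oplus>\<^bsub>K\<^esub> \<one>\<^bsub>K\<^esub>) \<odot> ?v = \<zero>"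
    using v by (simp add: M.r_neg)
  \<comment> \<open>Here the characteristic enters: the scalar 1 + 1 is nonzero and can be divided
    out.\<close>
  then have "?v = inv\<^bsub>K\<^esub> (\<one>\<^bsub>K\<^esub> \<oplus>\<^bsub>K\<^esub> \<one>\<^bsub>K\<^esub>) \<odot> \<zero>"
    using v two by (intro mult_inverse) auto
  then have "?v = \<zero>"
    using two by (simp add: field_Units R.Units_inv_closed)
  then show ?thesis
    using assms(5,6) inner by simp
qed

end

theorem corollary5p6:
  fixes K :: "('k, 'c) ring_scheme" and L :: "('k, 'a, 'd) lie_algebra_scheme"
  assumes "lie_algebra K L"
    and "vectorspace.fin_dim K L"
    and "perfect K L"
    and "ring_char K \<noteq> 2"
  shows "(taut K L \<longrightarrow> only_trivial_cpa K L) \<and>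
    (lie_solvable K (Out K L) \<longrightarrow> only_trivial_cpa K L)"
proof -
  interpret L: lie_algebra K L by fact
  have "only_trivial_cpa K L" if taut: "taut K L"
    unfolding only_trivial_cpa_def
  proof (intro allI impI ballI)
    fix P x y
    assume "cpa_structure K L P" and xy: "x \<in> carrier L" "y \<in> carrier L"
    then interpret cpa_structure K L P by simp
    obtain f where "\<And>x. x \<in> carrier L \<Longrightarrow> f x \<in> carrier L"
      and "\<And>x y. \<lbrakk>x \<in> carrier L; y \<in> carrier L\<rbrakk> \<Longrightarrow> P x y = \<lbrace>f x, y\<rbrace>\<^bsub>L\<^esub>"
      using taut_imp_inner[OF taut] by blast
    then show "P x y = \<zero>\<^bsub>L\<^esub>"
      using assms(3) L.one_plus_one_neq_zero[OF assms(4)] xy by (intro inner_imp_trivial)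
  qed
  then show ?thesis
    using L.solvable_Out_imp_taut[OF assms(3)] by blast
qed

end
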